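(* Let the observation likelihood belong to the class of elliptically symmetric families $$g^{d_x}(y\mid x)=\phi\big(\psi(\|y-h^{d_x}(x)\|_R)\big),\qquad x\in\mathcal X,\ y\in\mathcal Y,$$ where $\phi:\mathbb R\to(0,\infty)$ is non-increasing, $\psi:[0,\infty)\to\mathbb R$ is non-decreasing, and $R\in\mathbb R^{d_y\times d_y}$ is a fixed symmetric positive definite matrix, independent of the state. Assume that the observation map $h^{d_x}:\mathcal X\to\mathcal Y$ satisfies $$M(d_x):=\sup_{x\in\mathcal X}\|h^{d_x}(x)\|<\infty,$$ and put $M_R^{d_x}:=\sup_{x\in\mathcal X}\|h^{d_x}(x)\|_R$. Then the second moment of the link function $\ell_Y^{\,d_x}$ is bounded by a one-dimensional radial integral, namely, $$\mathbb E\left[\|\ell_Y^{\,d_x}\|_{L^2(\pi_0)}^2\right]\le\mathcal S_R^{d_y}\int_0^\infty\frac{\phi^2\big(\psi(r)\big)}{\phi\big(\psi(r+2M_R^{d_x})\big)}\,r^{d_y-1}\,\mathrm dr,\qquad \mathcal S_R^{d_y}:=|R|^{1/2}\,\frac{2\pi^{d_y/2}}{\Gamma(d_y/2)}.$$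
   Context: $\mathcal X\subseteq\mathbb R^{d_x}$ and $\mathcal Y\subseteq\mathbb R^{d_y}$; $\pi_0$ is a probability measure on $\mathcal X$ (the prior law of the state $X$). The observation model is $Y=h^{d_x}(X)+V$, where $h^{d_x}$ is a (generally nonlinear) deterministic function, $X\sim\pi_0$, and the noise $V$ is independent of $X$ and admits a density on $\mathcal Y$; given $X=x$, $Y$ has density $g^{d_x}(\cdot\mid x)$ with respect to Lebesgue measure on $\mathcal Y$ (so $\int_{\mathcal Y}g^{d_x}(y\mid x)\,\mathrm dy=1$ for all $x$). Here $\|\cdot\|$ is the Euclidean norm, $\|y\|_R:=\sqrt{y^\top R y}$ is the Mahalanobis norm, $|R|$ is the determinant of $R$, and $\Gamma$ is the Gamma function. Write $g_y^{d_x}(x):=g^{d_x}(y\mid x)$ and $\pi_0(g_y^{d_x}):=\int_{\mathcal X}g_y^{d_x}(x)\,\pi_0(\mathrm dx)$. It is assumed throughout that $g_y^{d_x}\in L^2(\pi_0)$ for all $y\in\mathcal Y$. The marginal law of $Y$ is $\eta(\mathrm dy)=\pi_0(g_y^{d_x})\,\mathrm dy$. The link function is the map $y\mapsto\ell_y^{\,d_x}:=g_y^{d_x}(\cdot)/\pi_0(g_y^{d_x})\in L^2(\pi_0)$, and $\mathbb E[\|\ell_Y^{\,d_x}\|_{L^2(\pi_0)}^2]=\int_{\mathcal Y}\|\ell_y^{\,d_x}\|_{L^2(\pi_0)}^2\,\eta(\mathrm dy)$.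
   Formalization: The constant uses |R|^{-1/2} instead of the printed |R|^{1/2}, which is false for ‖y‖_R=√(yᵀRy) when |R|<1 (d_y=1, h=0, R=1/4, g=N(0,4): left side 1, printed right side 1/4); for |R|≥1 the printed bound follows. *)

theory Defs
  imports "HOL-Probability.Probability"
begin

definition symmetric_posdef :: "real ^ 'n ^ 'n \<Rightarrow> bool" where
  "symmetric_posdef R \<longleftrightarrow> transpose R = R \<and> (\<forall>v. v \<noteq> 0 \<longrightarrow> 0 < v \<bullet> (R *v v))"

(* The matrix R itself, not its inverse, appears in the quadratic form. *)
definition mahalanobis_norm :: "real ^ 'n ^ 'n \<Rightarrow> real ^ 'n \<Rightarrow> real" where
  "mahalanobis_norm R y = sqrt (y \<bullet> (R *v y))"

definition in_L2 :: "'a measure \<Rightarrow> ('a \<Rightarrow> real) \<Rightarrow> bool" where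
  "in_L2 M f \<longleftrightarrow> f \<in> borel_measurable M \<and> integrable M (\<lambda>x. (f x)\<^sup>2)"

definition L2_norm :: "'a measure \<Rightarrow> ('a \<Rightarrow> real) \<Rightarrow> real" where
  "L2_norm M f = sqrt (\<integral>x. (f x)\<^sup>2 \<partial>M)"

(* The likelihood takes the observation first: g y x is g(y | x), so g y is the function g_y. *)
definition evidence :: "'a measure \<Rightarrow> ('b \<Rightarrow> 'a \<Rightarrow> real) \<Rightarrow> 'b \<Rightarrow> real" where
  "evidence \<pi>\<^sub>0 g y = (\<integral>x. g y x \<partial>\<pi>\<^sub>0)"

definition link :: "'a measure \<Rightarrow> ('b \<Rightarrow> 'a \<Rightarrow> real) \<Rightarrow> 'b \<Rightarrow> 'a \<Rightarrow> real" where
  "link \<pi>\<^sub>0 g y = (\<lambda>x. g y x / evidence \<pi>\<^sub>0 g y)"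

(* The surface area of the unit sphere times the Jacobian |R|^(-1/2) of y = R^(-1/2) z, under
   which the R-norm of y is the Euclidean norm of z.  The source prints |R|^(1/2), which goes
   with the quadratic form of the inverse of R.  For the R-norm as defined above that exponent
   would make the radial bound false: if h = 0 and the observation space is the whole space,
   the second moment is 1, and the bound with |R|^(1/2) would be |R|, possibly below 1. *)
definition surface_const :: "real ^ 'n ^ 'n \<Rightarrow> real" where
  "surface_const R = det R powr (- 1 / 2) *
     (2 * pi powr (real CARD('n) / 2) / Gamma (real CARD('n) / 2))"

end

(* Since Y has density pi_0(g_y), the second moment of the link is the integral of
   g(y | x)^2 / pi_0(g_y) over pi_0(dx) dy.  For fixed x, the triangle inequality for the R-norm
   bounds every |y - h(x')|_R by r + 2 M_R, where r = |y - h(x)|_R, so monotonicity gives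
   pi_0(g_y) >= phi(psi(r + 2 M_R)).  The integrand is thus bounded by a function of r alone, and
   the pushforward of Lebesgue measure under the R-norm has density surface_const R * r^(d_y - 1)
   on the half-line, because R-balls are linear images of Euclidean balls. *)

theory Submission
  imports Defs
begin

section \<open>Volume of linear images\<close>

text \<open>The swap is a linear involution that sends boxes to boxes and only permutes the side
  lengths. Their product is therefore unchanged, and for a linear map the scaling factor on boxes
  carries over to all measurable sets of finite measure.\<close>

lemma measure_lebesgue_coordinate_swap:
  fixes m n :: "'n::finite" and S :: "(real ^ 'n) set"
  defines "f \<equiv> \<lambda>x :: real ^ 'n. \<chi> i. x $ Transposition.transpose m n i"
  assumes "S \<in> lmeasurable"
  shows "f ` S \<in> lmeasurable" "measure lebesgue (f ` S) = measure lebesgue S"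
proof -
  have "linear f"
    by (rule linearI) (simp_all add: f_def vec_eq_iff)
  have ff: "f (f x) = x" for x
    by (simp add: f_def vec_eq_iff)
  have sub: "f ` cbox a b \<subseteq> cbox (f a) (f b)" for a b
    by (auto simp: f_def mem_box_cart)
  have box: "f ` cbox a b = cbox (f a) (f b)" for a b
  proof
    \<comment> \<open>The reverse inclusion is \<open>sub\<close> at the swapped corners, because
      \<open>f\<close> is its own inverse.\<close>
    show "cbox (f a) (f b) \<subseteq> f ` cbox a b"
    proof
      fix y assume "y \<in> cbox (f a) (f b)"
      then have "f y \<in> cbox a b"
        using sub[of "f a" "f b"] by (auto simp: ff)
      then show "y \<in> f ` cbox a b"
        using ff[of y] by (metis image_eqI)
    qed
  qed (rule sub)
  have "measure lebesgue (cbox (f a) (f b)) = measure lebesgue (cbox a b)" for a b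
  proof (cases "cbox a b = {}")
    case False
    moreover from this have "cbox (f a) (f b) \<noteq> {}"
      using box[of a b] by auto
    moreover have "(\<Prod>i\<in>UNIV. f b $ i - f a $ i) = (\<Prod>i\<in>UNIV. b $ i - a $ i)"
      using prod.permute[OF permutes_swap_id, of m UNIV n "\<lambda>i. b $ i - a $ i"]
      by (simp add: f_def o_def)
    ultimately show ?thesis
      by (simp add: content_cbox_cart)
  next
    case True
    then show ?thesis
      using box[of a b] by simp
  qed
  then show "f ` S \<in> lmeasurable" "measure lebesgue (f ` S) = measure lebesgue S"
    using measure_linear_sufficient[OF \<open>linear f\<close> assms(2), of 1] by (simp_all add: box)
qed

text \<open>As for the swap, it is enough to treat boxes. \<open>measure_shear_interval\<close>
  wants a nonnegative lower corner in coordinate \<open>n\<close>, so each box is first translated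
  to have its lower corner at 0.\<close>

lemma measure_lebesgue_shear:
  fixes m n :: "'n::finite" and S :: "(real ^ 'n) set"
  defines "f \<equiv> \<lambda>x :: real ^ 'n. \<chi> i. if i = m then x $ m + x $ n else x $ i"
  assumes "m \<noteq> n" "S \<in> lmeasurable"
  shows "f ` S \<in> lmeasurable" "measure lebesgue (f ` S) = measure lebesgue S"
proof -
  have "linear f"
    by (rule linearI) (auto simp: f_def vec_eq_iff algebra_simps)
  have "measure lebesgue (f ` cbox a b) = measure lebesgue (cbox a b)" for a b
  proof (cases "cbox a b = {}")
    case False
    have box: "cbox a b = (+) a ` cbox 0 (b - a)"
      by (simp flip: cbox_translation)
    with False have ne: "cbox 0 (b - a) \<noteq> {}"
      by blast
    have "f ` cbox a b = (+) (f a) ` f ` cbox 0 (b - a)"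
      unfolding box image_image linear_add[OF \<open>linear f\<close>] ..
    then have "measure lebesgue (f ` cbox a b) = measure lebesgue (f ` cbox 0 (b - a))"
      by (simp only: measure_translation)
    also have "\<dots> = measure lebesgue (cbox 0 (b - a))"
      unfolding f_def by (rule measure_shear_interval[OF \<open>m \<noteq> n\<close> ne]) simp
    also have "\<dots> = measure lebesgue (cbox a b)"
      unfolding box by (simp only: measure_translation)
    finally show ?thesis .
  qed simp
  then show "f ` S \<in> lmeasurable" "measure lebesgue (f ` S) = measure lebesgue S"
    using measure_linear_sufficient[OF \<open>linear f\<close> assms(3), of 1] by simp_all
qed

text \<open>The corresponding result of the library needs a well-ordered index type.\<close>

lemma measure_lebesgue_linear_image:
  fixes f :: "real ^ 'n \<Rightarrow> real ^ 'n"
  assumes "linear f" "S \<in> lmeasurable"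
  shows "f ` S \<in> lmeasurable \<and> measure lebesgue (f ` S) = \<bar>det (matrix f)\<bar> * measure lebesgue S"
  using assms
proof (induction f arbitrary: S rule: induct_linear_elementary[consumes 1])
  case (1 f g)
  have "f ` g ` S \<in> lmeasurable"
    "measure lebesgue (f ` g ` S) = \<bar>det (matrix f)\<bar> * (\<bar>det (matrix g)\<bar> * measure lebesgue S)"
    using 1 by auto
  then show ?case
    using matrix_compose[OF \<open>linear g\<close> \<open>linear f\<close>] by (simp add: image_image o_def det_mul abs_mult)
next
  case (2 f i)
  \<comment> \<open>Coordinate \<open>i\<close> of \<open>f\<close> vanishes identically, so
    \<open>f\<close> is singular: the determinant is 0 and the image is negligible, and both sides
    of the volume formula are 0.\<close>
  have "\<not> surj f"
    using 2(2) by (metis one_neq_zero surjD vec_component)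
  then have "\<not> inj f"
    using \<open>linear f\<close> linear_injective_imp_surjective by blast
  then have "det (matrix f) = 0"
    using det_nz_iff_inj[OF \<open>linear f\<close>] by blast
  moreover have "negligible (f ` S)"
    by (rule negligible_linear_singular_image[OF \<open>linear f\<close> \<open>\<not> inj f\<close>])
  ultimately show ?case
    by (simp add: negligible_iff_measure)
next
  case (3 c)
  then show ?case
    using measurable_stretch[OF 3, of c] measure_stretch[OF 3, of c]
    by (simp add: matrix_def axis_def det_diagonal)
next
  case (4 m n)
  \<comment> \<open>The matrix is the identity with two rows exchanged (or the identity itself when
    \<open>m = n\<close>), so its determinant is the sign of a permutation.\<close>
  have "matrix (\<lambda>x :: real ^ 'n. \<chi> i. x $ Transposition.transpose m n i) =
      (\<chi> i. mat 1 $ Transposition.transpose m n i)"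
    by (auto simp: matrix_def mat_def axis_def vec_eq_iff)
  then have "\<bar>det (matrix (\<lambda>x :: real ^ 'n. \<chi> i. x $ Transposition.transpose m n i))\<bar> = 1"
    by (simp add: det_permute_rows permutes_swap_id sign_swap_id abs_mult)
  then show ?case
    using measure_lebesgue_coordinate_swap[OF 4(2), of m n] by simp
next
  case (5 m n)
  let ?f = "\<lambda>x :: real ^ 'n. \<chi> i. if i = m then x $ m + x $ n else x $ i"
  \<comment> \<open>The shear adds row \<open>n\<close> of the identity to row \<open>m\<close>,
    which leaves the determinant at 1.\<close>
  have "matrix ?f = (\<chi> k. if k = m then row m (mat 1) + 1 *s row n (mat 1) else row k (mat 1))"
    by (auto simp: matrix_def mat_def axis_def row_def vec_eq_iff)
  then have "det (matrix ?f) = 1"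
    using det_row_operation[OF \<open>m \<noteq> n\<close>, of "mat 1 :: real ^ 'n ^ 'n" 1] by simp
  then show ?case
    using measure_lebesgue_shear[OF 5] by simp
qed

section \<open>Reducing the quadratic form to the Euclidean one\<close>

text \<open>This is Gram-Schmidt for the inner product \<open>v \<bullet> (R *v w)\<close>, by
  induction on the index set. Indexing the vectors by \<open>'n\<close> lets them serve as the
  columns of a square matrix.\<close>

lemma symmetric_posdef_orthonormal_family:
  fixes R :: "real ^ 'n ^ 'n"
  assumes R: "symmetric_posdef R"
  shows "\<exists>b :: 'n \<Rightarrow> real ^ 'n. \<forall>i\<in>I. \<forall>j\<in>I. b i \<bullet> (R *v b j) = of_bool (i = j)"
proof (induction I rule: finite_induct[OF finite])
  case (2 k I)
  then obtain b :: "'n \<Rightarrow> real ^ 'n"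
    where b: "\<And>i j. i \<in> I \<Longrightarrow> j \<in> I \<Longrightarrow> b i \<bullet> (R *v b j) = of_bool (i = j)"
    by blast
  have sym: "v \<bullet> (R *v w) = w \<bullet> (R *v v)" for v w
    using R dot_lmul_matrix[of v R w]
    by (simp add: symmetric_posdef_def inner_commute flip: transpose_matrix_vector)
  \<comment> \<open>Fewer than \<open>CARD('n)\<close> vectors have been chosen, so some
    \<open>x\<close> lies outside their span.\<close>
  have "dim (span (b ` I)) \<le> card I"
    using card_image_le[OF \<open>finite I\<close>, of b] dim_le_card'[of "b ` I"] \<open>finite I\<close> by simp
  also have "card I < CARD('n)"
    using \<open>k \<notin> I\<close> by (intro psubset_card_mono) auto
  finally have "dim (span (b ` I)) < dim (UNIV :: (real ^ 'n) set)"
    by simp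
  then have "span (b ` I) \<noteq> UNIV"
    by (metis less_irrefl)
  then obtain x where x: "x \<notin> span (b ` I)"
    by blast
  \<comment> \<open>Subtracting from \<open>x\<close> its projection, taken in the inner product of
    \<open>R\<close>, leaves a nonzero vector orthogonal to all earlier ones.\<close>
  define y where "y = x - (\<Sum>i\<in>I. (b i \<bullet> (R *v x)) *\<^sub>R b i)"
  have "(\<Sum>i\<in>I. (b i \<bullet> (R *v x)) *\<^sub>R b i) \<in> span (b ` I)"
    by (intro span_sum span_scale span_base) simp
  with x have "y \<noteq> 0"
    by (auto simp: y_def)
  then have c: "0 < y \<bullet> (R *v y)"
    using R by (simp add: symmetric_posdef_def)
  have lin: "linear ((*v) R)"
    by simp
  have orth: "b j \<bullet> (R *v y) = 0" if "j \<in> I" for j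
  proof -
    have "b j \<bullet> (R *v y) =
        b j \<bullet> (R *v x) - (\<Sum>i\<in>I. (b i \<bullet> (R *v x)) * (b j \<bullet> (R *v b i)))"
      by (simp add: y_def linear_diff[OF lin] linear_sum[OF lin] linear_scale[OF lin]
          inner_diff_right inner_sum_right matrix_vector_mult_scaleR)
    also have "(\<Sum>i\<in>I. (b i \<bullet> (R *v x)) * (b j \<bullet> (R *v b i))) = b j \<bullet> (R *v x)"
      using that \<open>finite I\<close> by (simp add: b of_bool_def if_distrib cong: if_cong)
    finally show ?thesis by simp
  qed
  define s where "s = y /\<^sub>R sqrt (y \<bullet> (R *v y))"
  have "s \<bullet> (R *v s) = (y \<bullet> (R *v y)) / (sqrt (y \<bullet> (R *v y)) * sqrt (y \<bullet> (R *v y)))"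
    unfolding s_def matrix_vector_mult_scaleR inner_scaleR_left inner_scaleR_right
    by (simp only: divide_inverse inverse_mult_distrib mult_ac)
  with c have "s \<bullet> (R *v s) = 1"
    by simp
  moreover have "b j \<bullet> (R *v s) = 0" if "j \<in> I" for j
    using orth[OF that] by (simp add: s_def matrix_vector_mult_scaleR)
  moreover from this have "s \<bullet> (R *v b j) = 0" if "j \<in> I" for j
    using sym[of s "b j"] that by metis
  ultimately have "\<forall>i\<in>insert k I. \<forall>j\<in>insert k I.
      (b(k := s)) i \<bullet> (R *v (b(k := s)) j) = of_bool (i = j)"
    using b \<open>k \<notin> I\<close> by auto
  then show ?case
    by blast
qed simp

text \<open>With an orthonormal basis for the form of \<open>R\<close> as the columns of
  \<open>P\<close>, entry (i, j) of the product is the form evaluated at the basis vectors i and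
  j.\<close>

lemma symmetric_posdef_congruent_identity:
  fixes R :: "real ^ 'n ^ 'n"
  assumes R: "symmetric_posdef R"
  obtains P :: "real ^ 'n ^ 'n" where "transpose P ** R ** P = mat 1"
proof -
  obtain b :: "'n \<Rightarrow> real ^ 'n" where b: "\<And>i j. b i \<bullet> (R *v b j) = of_bool (i = j)"
    using symmetric_posdef_orthonormal_family[OF R, of UNIV] by auto
  let ?P = "transpose (\<chi> i. b i)"
  have "(transpose ?P ** R ** ?P) $ i $ j = b i \<bullet> (R *v b j)" for i j
  proof -
    have "(transpose ?P ** R ** ?P) $ i $ j = row i (transpose ?P) \<bullet> column j (R ** ?P)"
      unfolding matrix_mul_assoc[symmetric]
      by (subst matrix_matrix_mult_def) (simp add: inner_vec_def row_def column_def)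
    also have "column j (R ** ?P) = R *v b j"
      by (simp add: column_def matrix_matrix_mult_def matrix_vector_mult_def transpose_def)
    finally show ?thesis
      by (simp add: row_def)
  qed
  then have "transpose ?P ** R ** ?P = mat 1"
    by (simp add: b vec_eq_iff mat_def)
  then show thesis
    by (rule that)
qed

text \<open>If \<open>P\<close> carries \<open>R\<close> to the identity by congruence, its inverse
  is \<open>Q = transpose P ** R\<close>; substituting y = P (Q y) in the quadratic form leaves the
  squared Euclidean norm of Q y. The determinant of \<open>P\<close> is the Jacobian that appears in
  \<open>surface_const\<close>.\<close>

lemma mahalanobis_norm_isometry:
  fixes R :: "real ^ 'n ^ 'n"
  assumes R: "symmetric_posdef R"
  obtains P Q :: "real ^ 'n ^ 'n"
  where "P ** Q = mat 1" "Q ** P = mat 1" "\<And>y. mahalanobis_norm R y = norm (Q *v y)"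
    "\<bar>det P\<bar> = det R powr (- 1 / 2)"
proof -
  obtain P :: "real ^ 'n ^ 'n" where P: "transpose P ** R ** P = mat 1"
    using symmetric_posdef_congruent_identity[OF R] by blast
  define Q where "Q = transpose P ** R"
  have QP: "Q ** P = mat 1"
    using P by (simp add: Q_def)
  then have PQ: "P ** Q = mat 1"
    by (rule matrix_left_right_inverse[THEN iffD1])
  have "mahalanobis_norm R y = norm (Q *v y)" for y
  proof -
    have "y = P *v (Q *v y)"
      by (simp add: matrix_vector_mul_assoc PQ)
    then have "y \<bullet> (R *v y) = (P *v (Q *v y)) \<bullet> (R *v y)"
      by metis
    also have "\<dots> = (Q *v y) \<bullet> (transpose P *v (R *v y))"
      by (metis dot_lmul_matrix inner_commute transpose_matrix_vector)
    also have "\<dots> = (Q *v y) \<bullet> (Q *v y)"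
      by (simp add: Q_def matrix_vector_mul_assoc)
    finally show ?thesis
      by (simp add: mahalanobis_norm_def norm_eq_sqrt_inner)
  qed
  moreover have "\<bar>det P\<bar> = det R powr (- 1 / 2)"
  proof -
    \<comment> \<open>Taking determinants in the congruence also shows that \<open>det R\<close> is
      positive, as the real power requires.\<close>
    have *: "(det P)\<^sup>2 * det R = 1"
      using arg_cong[OF P, of det] by (simp add: det_mul power2_eq_square mult_ac)
    then have "0 < det R"
      by (metis not_less mult_nonneg_nonpos not_one_le_zero zero_le_power2)
    then have "\<bar>det P\<bar> = 1 / sqrt (det R)"
      using * by (metis nonzero_mult_div_cancel_right real_sqrt_abs real_sqrt_divide real_sqrt_one
          order_less_irrefl)
    also have "\<dots> = det R powr (- 1 / 2)"
      using \<open>0 < det R\<close> by (simp add: powr_minus_divide powr_half_sqrt)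
    finally show ?thesis .
  qed
  ultimately show thesis
    using PQ QP that by blast
qed

section \<open>Radial integration for the R-norm\<close>

lemma mahalanobis_norm_measurable [measurable]: "mahalanobis_norm R \<in> borel_measurable borel"
proof -
  have "continuous_on UNIV (mahalanobis_norm R)"
    unfolding mahalanobis_norm_def by (intro continuous_intros linear_continuous_on) simp
  then show ?thesis
    by (rule borel_measurable_continuous_onI)
qed

text \<open>The surface area of the unit sphere is the dimension times the volume of the unit ball,
  by the recursion Gamma(z + 1) = z Gamma(z) at half the dimension.\<close>

lemma surface_const_eq:
  "surface_const (R :: real ^ 'n ^ 'n) =
    det R powr (- 1 / 2) * unit_ball_vol (real CARD('n)) * real CARD('n)"
proof -
  have *: "Gamma (real CARD('n) / 2 + 1) = real CARD('n) / 2 * Gamma (real CARD('n) / 2)"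
    by (rule Gamma_plus1) (use nonpos_Ints_nonpos[of "real CARD('n) / 2"] in force)
  show ?thesis
    unfolding surface_const_def unit_ball_vol_def * by simp
qed

text \<open>The R-ball is the image under \<open>P\<close> of the Euclidean ball of the same radius,
  so its volume is multiplied by \<bar>det P\<bar>.\<close>

lemma emeasure_mahalanobis_ball:
  fixes R :: "real ^ 'n ^ 'n"
  assumes R: "symmetric_posdef R" and "0 \<le> r"
  shows "emeasure lborel {y. mahalanobis_norm R y \<le> r} =
    ennreal (det R powr (- 1 / 2) * unit_ball_vol (real CARD('n)) * r ^ CARD('n))"
proof -
  obtain P Q :: "real ^ 'n ^ 'n" where PQ: "P ** Q = mat 1" "Q ** P = mat 1"
    and norm: "\<And>y. mahalanobis_norm R y = norm (Q *v y)"
    and det: "\<bar>det P\<bar> = det R powr (- 1 / 2)"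
    using mahalanobis_norm_isometry[OF R] by blast
  have ball: "{y. mahalanobis_norm R y \<le> r} = (*v) P ` cball 0 r"
  proof (intro set_eqI iffI)
    fix y assume "y \<in> {y. mahalanobis_norm R y \<le> r}"
    then show "y \<in> (*v) P ` cball 0 r"
      by (intro image_eqI[of _ _ "Q *v y"]) (auto simp: norm matrix_vector_mul_assoc PQ)
  qed (auto simp: norm matrix_vector_mul_assoc PQ)
  have meas: "(*v) P ` cball 0 r \<in> lmeasurable"
    and eq: "measure lebesgue ((*v) P ` cball 0 r) = \<bar>det P\<bar> * measure lebesgue (cball 0 r :: (real ^ 'n) set)"
    using measure_lebesgue_linear_image[of "(*v) P" "cball 0 r"] by auto
  have "emeasure lborel {y. mahalanobis_norm R y \<le> r} = emeasure lebesgue ((*v) P ` cball 0 r)"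
    unfolding ball[symmetric] by (simp add: emeasure_completion)
  also have "\<dots> = ennreal (measure lebesgue ((*v) P ` cball 0 r))"
    using meas by (rule emeasure_eq_measure2)
  also have "\<dots> = ennreal (det R powr (- 1 / 2) * (unit_ball_vol (real CARD('n)) * r ^ CARD('n)))"
    unfolding eq det using \<open>0 \<le> r\<close> by (simp add: content_cball)
  finally show ?thesis
    by (simp add: mult.assoc)
qed

text \<open>Half-lines \<open>{..r}\<close> are an intersection-stable generator of the Borel sets,
  so it suffices to compare masses there: the volume of an R-ball on one side, the integral of its
  derivative in the radius on the other.\<close>

lemma distr_mahalanobis_norm:
  fixes R :: "real ^ 'n ^ 'n"
  assumes R: "symmetric_posdef R"
  shows "distr lborel borel (mahalanobis_norm R) =
    density lborel (\<lambda>r. ennreal (surface_const R * r ^ (CARD('n) - 1)) * indicator {0..} r)"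
    (is "?D = density lborel ?f")
proof (rule measure_eqI_generator_eq)
  let ?c = "det R powr (- 1 / 2) * unit_ball_vol (real CARD('n))"
  have D: "emeasure ?D {..r} = (if 0 \<le> r then ennreal (?c * r ^ CARD('n)) else 0)" for r
  proof -
    have "emeasure ?D {..r} = emeasure lborel {y. mahalanobis_norm R y \<le> r}"
      by (subst emeasure_distr) (auto simp: vimage_def)
    moreover have "{y. mahalanobis_norm R y \<le> r} = {}" if "r < 0"
    proof -
      have "0 \<le> y \<bullet> (R *v y)" for y
        using R by (cases "y = 0") (auto simp: symmetric_posdef_def less_imp_le)
      then have "0 \<le> mahalanobis_norm R y" for y
        by (simp add: mahalanobis_norm_def)
      then show ?thesis
        using that by (metis (no_types, lifting) Collect_empty_eq order.strict_trans1 not_less)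
    qed
    ultimately show ?thesis
      using emeasure_mahalanobis_ball[OF R] by auto
  qed
  show "emeasure ?D X = emeasure (density lborel ?f) X" if X_atMost: "X \<in> range atMost" for X
  proof -
    obtain r where X: "X = {..r}"
      using X_atMost by auto
    have "emeasure (density lborel ?f) {..r} =
        (\<integral>\<^sup>+t. ennreal (surface_const R * t ^ (CARD('n) - 1)) * indicator {0..r} t \<partial>lborel)"
      by (subst emeasure_density) (auto intro!: nn_integral_cong split: split_indicator)
    also have "\<dots> = (if 0 \<le> r then ennreal (?c * r ^ CARD('n)) else 0)"
    proof (cases "0 \<le> r")
      case True
      have "(\<integral>\<^sup>+t. ennreal (surface_const R * t ^ (CARD('n) - 1)) * indicator {0..r} t \<partial>lborel) =
          ennreal (?c * r ^ CARD('n) - ?c * 0 ^ CARD('n))"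
      proof (rule nn_integral_FTC_Icc[OF _ _ _ True])
        show "((\<lambda>t. ?c * t ^ CARD('n)) has_real_derivative surface_const R * t ^ (CARD('n) - 1)) (at t)"
          for t
          unfolding surface_const_eq
          by (auto intro!: derivative_eq_intros)
        show "0 \<le> surface_const R * t ^ (CARD('n) - 1)" if "t \<in> {0..r}" for t
          using that by (simp add: surface_const_eq)
      qed simp
      then show ?thesis
        \<comment> \<open>The antiderivative vanishes at 0 because the dimension is
          positive.\<close>
        using True by (simp add: zero_power)
    qed simp
    finally show ?thesis
      unfolding X D by simp
  qed
  show "Int_stable (range atMost :: real set set)"
    by (auto simp: Int_stable_def)
  show "sets ?D = sigma_sets UNIV (range atMost)"
    "sets (density lborel ?f) = sigma_sets UNIV (range atMost)"
    by (simp_all add: borel_eq_atMost)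
  \<comment> \<open>The uniqueness of the extension needs a countable cover by generators of finite
    mass.\<close>
  show "range (\<lambda>i :: nat. {..real i}) \<subseteq> range atMost"
    by auto
  show "(\<Union>i :: nat. {..real i}) = UNIV"
    by (auto simp: real_arch_simple)
  show "emeasure ?D {..real i} \<noteq> \<infinity>" for i
    by (simp add: D)
qed auto

text \<open>Translation invariance moves the centre \<open>a\<close> to the origin; the rest is
  integration against the pushforward of Lebesgue measure.\<close>

lemma nn_integral_mahalanobis_norm:
  fixes R :: "real ^ 'n ^ 'n"
  assumes R: "symmetric_posdef R" and [measurable]: "f \<in> borel_measurable borel"
  shows "(\<integral>\<^sup>+y. f (mahalanobis_norm R (y - a)) \<partial>lborel) =
    ennreal (surface_const R) * (\<integral>\<^sup>+r\<in>{0..}. f r * ennreal (r ^ (CARD('n) - 1)) \<partial>lborel)"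
proof -
  have "(\<integral>\<^sup>+y. f (mahalanobis_norm R (y - a)) \<partial>lborel) =
      (\<integral>\<^sup>+y. f (mahalanobis_norm R (y - a)) \<partial>distr lborel borel ((+) a))"
    by (simp add: lborel_distr_plus)
  also have "\<dots> = (\<integral>\<^sup>+y. f (mahalanobis_norm R y) \<partial>lborel)"
    by (subst nn_integral_distr) simp_all
  also have "\<dots> = (\<integral>\<^sup>+r. f r \<partial>distr lborel borel (mahalanobis_norm R))"
    by (subst nn_integral_distr) simp_all
  also have "\<dots> = (\<integral>\<^sup>+r. ennreal (surface_const R) *
      (f r * ennreal (r ^ (CARD('n) - 1)) * indicator {0..} r) \<partial>lborel)"
    unfolding distr_mahalanobis_norm[OF R]
    by (subst nn_integral_density)
      (auto intro!: nn_integral_cong simp: surface_const_eq ennreal_mult' mult_ac split: split_indicator)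
  also have "\<dots> = ennreal (surface_const R) *
      (\<integral>\<^sup>+r\<in>{0..}. f r * ennreal (r ^ (CARD('n) - 1)) \<partial>lborel)"
    by (subst nn_integral_cmult) simp_all
  finally show ?thesis .
qed

section \<open>Norm properties and boundedness\<close>

lemma mahalanobis_norm_add_le:
  fixes R :: "real ^ 'n ^ 'n"
  assumes R: "symmetric_posdef R"
  shows "mahalanobis_norm R (v + w) \<le> mahalanobis_norm R v + mahalanobis_norm R w"
proof -
  obtain Q :: "real ^ 'n ^ 'n" where "\<And>y. mahalanobis_norm R y = norm (Q *v y)"
    using mahalanobis_norm_isometry[OF R] by blast
  then show ?thesis
    by (simp add: matrix_vector_right_distrib norm_triangle_ineq)
qed

lemma mahalanobis_norm_nonneg:
  fixes R :: "real ^ 'n ^ 'n"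
  assumes R: "symmetric_posdef R"
  shows "0 \<le> mahalanobis_norm R v"
proof -
  obtain Q :: "real ^ 'n ^ 'n" where "\<And>y. mahalanobis_norm R y = norm (Q *v y)"
    using mahalanobis_norm_isometry[OF R] by blast
  then show ?thesis
    by simp
qed

lemma mahalanobis_norm_uminus: "mahalanobis_norm R (- v) = mahalanobis_norm R v"
  by (simp add: mahalanobis_norm_def linear_neg[OF matrix_vector_mul_linear])

text \<open>The R-norm is continuous, hence bounded on a closed ball containing the values of
  \<open>h\<close>. This makes the real supremum \<open>M\<^sub>R\<close> of the theorem a genuine
  upper bound.\<close>

lemma bdd_above_mahalanobis_norm:
  assumes "bdd_above ((\<lambda>x. norm (h x)) ` X)"
  shows "bdd_above ((\<lambda>x. mahalanobis_norm R (h x)) ` X)"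
proof -
  obtain B where B: "\<And>x. x \<in> X \<Longrightarrow> norm (h x) \<le> B"
    using assms by (auto simp: bdd_above_def)
  have "bounded (mahalanobis_norm R ` cball 0 B)"
    unfolding mahalanobis_norm_def
    by (intro compact_imp_bounded compact_continuous_image continuous_intros linear_continuous_on)
      simp_all
  then have "bdd_above (mahalanobis_norm R ` cball 0 B)"
    by (rule bounded_imp_bdd_above)
  then show ?thesis
    by (rule bdd_above_mono) (use B in auto)
qed

section \<open>The radial bound on the second moment\<close>

theorem theorem4p1:
  fixes \<Omega> :: "'w measure"
    and X :: "(real ^ 'dx) set"
    and Y :: "(real ^ 'dy) set"
    and \<pi>\<^sub>0 :: "(real ^ 'dx) measure"
    and Xs :: "'w \<Rightarrow> real ^ 'dx"
    and V Ys :: "'w \<Rightarrow> real ^ 'dy"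
    and p :: "real ^ 'dy \<Rightarrow> ennreal"
    and h :: "real ^ 'dx \<Rightarrow> real ^ 'dy"
    and g :: "real ^ 'dy \<Rightarrow> real ^ 'dx \<Rightarrow> real"
    and \<phi> \<psi> :: "real \<Rightarrow> real"
    and R :: "real ^ 'dy ^ 'dy"
  assumes Y_borel: "Y \<in> sets borel"
    and prior: "prob_space \<pi>\<^sub>0" "sets \<pi>\<^sub>0 = sets (restrict_space borel X)"
    and prob: "prob_space \<Omega>"
    and state: "Xs \<in> measurable \<Omega> \<pi>\<^sub>0" "distr \<Omega> \<pi>\<^sub>0 Xs = \<pi>\<^sub>0"
    and noise_indep: "prob_space.indep_set \<Omega>
          {Xs -` A \<inter> space \<Omega> |A. A \<in> sets \<pi>\<^sub>0} {V -` B \<inter> space \<Omega> |B. B \<in> sets borel}"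
    and noise_density: "distributed \<Omega> lborel V p"
    and observation: "\<And>\<omega>. \<omega> \<in> space \<Omega> \<Longrightarrow> Ys \<omega> = h (Xs \<omega>) + V \<omega>"
    and likelihood: "distributed \<Omega> (\<pi>\<^sub>0 \<Otimes>\<^sub>M restrict_space lborel Y)
          (\<lambda>\<omega>. (Xs \<omega>, Ys \<omega>)) (\<lambda>(x, y). ennreal (g y x))"
    and normalized: "\<And>x. x \<in> X \<Longrightarrow> (\<integral>\<^sup>+y\<in>Y. ennreal (g y x) \<partial>lborel) = 1"
    and square_integrable: "\<And>y. y \<in> Y \<Longrightarrow> in_L2 \<pi>\<^sub>0 (g y)"
    and elliptical: "\<And>x y. x \<in> X \<Longrightarrow> y \<in> Y \<Longrightarrow>
          g y x = \<phi> (\<psi> (mahalanobis_norm R (y - h x)))"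
    and \<phi>: "\<And>u. 0 < \<phi> u" "antimono \<phi>"
    and \<psi>: "mono_on {0..} \<psi>"
    and R: "symmetric_posdef R"
    and h_maps: "h \<in> X \<rightarrow> Y"
    and h_bounded: "bdd_above ((\<lambda>x. norm (h x)) ` X)"
  defines "M\<^sub>R \<equiv> (SUP x\<in>X. mahalanobis_norm R (h x))"
  shows "(\<integral>\<^sup>+\<omega>. ennreal ((L2_norm \<pi>\<^sub>0 (link \<pi>\<^sub>0 g (Ys \<omega>)))\<^sup>2) \<partial>\<Omega>)
    \<le> ennreal (surface_const R) *
      (\<integral>\<^sup>+r\<in>{0..}. ennreal ((\<phi> (\<psi> r))\<^sup>2 / \<phi> (\<psi> (r + 2 * M\<^sub>R)) * r ^ (CARD('dy) - 1)) \<partial>lborel)"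
proof -
  interpret \<pi>: prob_space \<pi>\<^sub>0
    by (rule prior)
  define N where "N = restrict_space lborel Y"
  interpret N: sigma_finite_measure N
    unfolding N_def using Y_borel
    by (intro sigma_finite_measure_restrict_space sigma_finite_lborel) simp
  interpret pair_sigma_finite \<pi>\<^sub>0 N ..
  have space_prior: "space \<pi>\<^sub>0 = X"
    using sets_eq_imp_space_eq[OF prior(2)] by (simp add: space_restrict_space)
  have space_N: "space N = Y"
    by (simp add: N_def space_restrict_space)

  \<comment> \<open>\<open>\<psi>\<close> is monotone on the nonnegative half-line only. Truncating
    its argument at 0 gives a profile that is non-increasing on the whole line and hence Borel
    measurable.\<close>
  define q where "q r = \<phi> (\<psi> (max 0 r))" for r
  have q_pos: "0 < q r" for r
    by (simp add: q_def \<phi>(1))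
  have q_antimono: "q s \<le> q r" if "r \<le> s" for r s
    unfolding q_def using that by (intro antimonoD[OF \<phi>(2)] mono_onD[OF \<psi>]) auto
  have "mono (\<lambda>r. - q r)"
    by (simp add: mono_def q_antimono)
  then have "(\<lambda>r. - (- q r)) \<in> borel_measurable borel"
    by (intro borel_measurable_uminus borel_measurable_mono)
  then have [measurable]: "q \<in> borel_measurable borel"
    by simp

  have g_q: "g y x = q (mahalanobis_norm R (y - h x))" if "x \<in> X" "y \<in> Y" for x y
    using that mahalanobis_norm_nonneg[OF R] by (simp add: elliptical q_def max_def)
  have g_pos: "0 < g y x" if "x \<in> X" "y \<in> Y" for x y
    using that by (simp add: g_q q_pos)
  have g_bounded: "g y x \<le> q 0" if "x \<in> X" "y \<in> Y" for x y
    using that mahalanobis_norm_nonneg[OF R] by (simp add: g_q q_antimono)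

  have norm_h: "mahalanobis_norm R (h x) \<le> M\<^sub>R" if "x \<in> X" for x
    unfolding M\<^sub>R_def by (rule cSUP_upper[OF that bdd_above_mahalanobis_norm[OF h_bounded]])
  \<comment> \<open>Changing the state from \<open>x\<close> to \<open>x'\<close> moves the centre
    by \<open>h x - h x'\<close>, whose R-norm is at most \<open>2 * M\<^sub>R\<close>.\<close>
  have norm_shift: "mahalanobis_norm R (y - h x') \<le> mahalanobis_norm R (y - h x) + 2 * M\<^sub>R"
    if "x \<in> X" "x' \<in> X" for x x' y
  proof -
    have "mahalanobis_norm R (y - h x') \<le> mahalanobis_norm R (y - h x) + mahalanobis_norm R (h x - h x')"
      using mahalanobis_norm_add_le[OF R, of "y - h x" "h x - h x'"] by simp
    moreover have "mahalanobis_norm R (h x - h x') \<le> mahalanobis_norm R (h x) + mahalanobis_norm R (h x')"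
      using mahalanobis_norm_add_le[OF R, of "h x" "- h x'"] by (simp add: mahalanobis_norm_uminus)
    ultimately show ?thesis
      using norm_h[OF that(1)] norm_h[OF that(2)] by simp
  qed

  have density: "(\<lambda>(x, y). ennreal (g y x)) \<in> borel_measurable (\<pi>\<^sub>0 \<Otimes>\<^sub>M N)"
    using distributed_borel_measurable[OF likelihood] by (simp add: N_def)
  have g_meas [measurable]: "(\<lambda>z. g (snd z) (fst z)) \<in> borel_measurable (\<pi>\<^sub>0 \<Otimes>\<^sub>M N)"
  proof -
    \<comment> \<open>The density is known to be measurable as an extended nonnegative function.
      Converting back recovers \<open>g\<close>, which is positive on the product of
      \<open>X\<close> and \<open>Y\<close>.\<close>
    have "(\<lambda>z. enn2real (case z of (x, y) \<Rightarrow> ennreal (g y x))) \<in> borel_measurable (\<pi>\<^sub>0 \<Otimes>\<^sub>M N)"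
      using density by measurable
    then show ?thesis
      by (rule measurable_cong[THEN iffD1, rotated])
        (use g_pos in \<open>auto simp: space_pair_measure space_prior space_N less_imp_le\<close>)
  qed
  have g_meas_swap [measurable]: "(\<lambda>z. g (fst z) (snd z)) \<in> borel_measurable (N \<Otimes>\<^sub>M \<pi>\<^sub>0)"
    using measurable_compose[OF measurable_pair_swap' g_meas] by (simp add: case_prod_unfold)
  have g_meas_x: "g y \<in> borel_measurable \<pi>\<^sub>0" if "y \<in> Y" for y
    using square_integrable[OF that] by (simp add: in_L2_def)
  have g_integrable: "integrable \<pi>\<^sub>0 (g y)" if "y \<in> Y" for y
  proof (rule \<pi>.integrable_const_bound[where B="q 0"])
    show "AE x in \<pi>\<^sub>0. norm (g y x) \<le> q 0"
      using that g_pos g_bounded by (intro AE_I2) (simp add: space_prior less_imp_le)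
  qed (rule g_meas_x[OF that])
  have evidence_ge: "c \<le> evidence \<pi>\<^sub>0 g y" if "y \<in> Y" "\<And>x. x \<in> X \<Longrightarrow> c \<le> g y x" for c y
    unfolding evidence_def using that
    by (intro \<pi>.integral_ge_const g_integrable AE_I2) (simp_all add: space_prior)
  \<comment> \<open>The evidence averages \<open>g y\<close> over all states, and each of these
    values is at least the profile at the shifted radius.\<close>
  have evidence_lower: "q (mahalanobis_norm R (y - h x) + 2 * M\<^sub>R) \<le> evidence \<pi>\<^sub>0 g y"
    if "x \<in> X" "y \<in> Y" for x y
    using that by (intro evidence_ge) (simp_all add: g_q q_antimono norm_shift)
  have X_nonempty: "X \<noteq> {}"
    using \<pi>.not_empty by (simp add: space_prior)
  have evidence_pos: "0 < evidence \<pi>\<^sub>0 g y" if "y \<in> Y" for y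
    using X_nonempty evidence_lower[OF _ that] q_pos by (meson ex_in_conv less_le_trans)
  have evidence_eq: "ennreal (evidence \<pi>\<^sub>0 g y) = (\<integral>\<^sup>+x. ennreal (g y x) \<partial>\<pi>\<^sub>0)" if "y \<in> Y" for y
    unfolding evidence_def using that g_pos
    by (intro nn_integral_eq_integral[symmetric] g_integrable AE_I2) (simp_all add: space_prior less_imp_le)
  have [measurable]: "evidence \<pi>\<^sub>0 g \<in> borel_measurable N"
    unfolding evidence_def
    using g_meas_swap
    by (intro \<pi>.borel_measurable_lebesgue_integral) (simp add: case_prod_unfold)

  \<comment> \<open>As a nonnegative integral, the squared norm of the link is measurable in
    \<open>y\<close> by Tonelli's theorem.\<close>
  define F where "F y = (\<integral>\<^sup>+x. ennreal ((g y x)\<^sup>2 / (evidence \<pi>\<^sub>0 g y)\<^sup>2) \<partial>\<pi>\<^sub>0)" for y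
  have F: "ennreal ((L2_norm \<pi>\<^sub>0 (link \<pi>\<^sub>0 g y))\<^sup>2) = F y" if "y \<in> Y" for y
  proof -
    \<comment> \<open>Square integrability keeps the Bochner integral inside \<open>L2_norm\<close>
      from taking its default value 0, so that it agrees with \<open>F\<close>.\<close>
    have "integrable \<pi>\<^sub>0 (\<lambda>x. (g y x)\<^sup>2 / (evidence \<pi>\<^sub>0 g y)\<^sup>2)"
      using square_integrable[OF that] by (simp add: in_L2_def)
    then have "F y = ennreal (\<integral>x. (g y x)\<^sup>2 / (evidence \<pi>\<^sub>0 g y)\<^sup>2 \<partial>\<pi>\<^sub>0)"
      unfolding F_def by (intro nn_integral_eq_integral) simp_all
    then show ?thesis
      by (simp add: L2_norm_def link_def power_divide)
  qed
  have F_meas [measurable]: "F \<in> borel_measurable N"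
    unfolding F_def
    by measurable
  \<comment> \<open>That the observation stays in \<open>Y\<close> comes from the measurability of
    the pair into the product space.\<close>
  have XY: "Xs \<omega> \<in> X" "Ys \<omega> \<in> Y" if "\<omega> \<in> space \<Omega>" for \<omega>
    using measurable_space[OF distributed_measurable[OF likelihood] that]
    by (auto simp: space_pair_measure space_prior space_N[unfolded N_def])

  define K where "K r = ennreal ((q r)\<^sup>2 / q (r + 2 * M\<^sub>R))" for r
  have [measurable]: "K \<in> borel_measurable borel"
    unfolding K_def by measurable

  have "(\<integral>\<^sup>+\<omega>. ennreal ((L2_norm \<pi>\<^sub>0 (link \<pi>\<^sub>0 g (Ys \<omega>)))\<^sup>2) \<partial>\<Omega>) =
      (\<integral>\<^sup>+\<omega>. F (snd (Xs \<omega>, Ys \<omega>)) \<partial>\<Omega>)"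
    by (intro nn_integral_cong) (simp add: F XY)
  also have "\<dots> = (\<integral>\<^sup>+z. (case z of (x, y) \<Rightarrow> ennreal (g y x)) * F (snd z) \<partial>(\<pi>\<^sub>0 \<Otimes>\<^sub>M N))"
    using likelihood unfolding N_def[symmetric] by (rule distributed_nn_integral[symmetric]) simp
  \<comment> \<open>With \<open>y\<close> outermost, the inner integral of \<open>g y\<close> turns
    into the evidence, the marginal density of the observation. It cancels one of the two evidence
    factors in the denominator of the squared link.\<close>
  also have "\<dots> = (\<integral>\<^sup>+y. \<integral>\<^sup>+x. ennreal (g y x) * F y \<partial>\<pi>\<^sub>0 \<partial>N)"
    by (subst nn_integral_snd[symmetric]) (use density in simp_all)
  also have "\<dots> = (\<integral>\<^sup>+y. \<integral>\<^sup>+x. ennreal ((g y x)\<^sup>2 / evidence \<pi>\<^sub>0 g y) \<partial>\<pi>\<^sub>0 \<partial>N)"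
  proof (rule nn_integral_cong)
    fix y assume "y \<in> space N"
    then have y: "y \<in> Y"
      by (simp add: space_N)
    have [measurable]: "g y \<in> borel_measurable \<pi>\<^sub>0"
      by (rule g_meas_x[OF y])
    have "(\<integral>\<^sup>+x. ennreal (g y x) * F y \<partial>\<pi>\<^sub>0) = ennreal (evidence \<pi>\<^sub>0 g y) * F y"
      by (subst nn_integral_multc) (simp_all add: evidence_eq[OF y])
    also have "\<dots> = (\<integral>\<^sup>+x. ennreal (evidence \<pi>\<^sub>0 g y) * ennreal ((g y x)\<^sup>2 / (evidence \<pi>\<^sub>0 g y)\<^sup>2) \<partial>\<pi>\<^sub>0)"
      unfolding F_def by (subst nn_integral_cmult) simp_all
    also have "\<dots> = (\<integral>\<^sup>+x. ennreal ((g y x)\<^sup>2 / evidence \<pi>\<^sub>0 g y) \<partial>\<pi>\<^sub>0)"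
      using evidence_pos[OF y]
      by (intro nn_integral_cong) (simp add: power2_eq_square flip: ennreal_mult')
    finally show "(\<integral>\<^sup>+x. ennreal (g y x) * F y \<partial>\<pi>\<^sub>0) =
        (\<integral>\<^sup>+x. ennreal ((g y x)\<^sup>2 / evidence \<pi>\<^sub>0 g y) \<partial>\<pi>\<^sub>0)" .
  qed
  also have "\<dots> = (\<integral>\<^sup>+x. \<integral>\<^sup>+y. ennreal ((g y x)\<^sup>2 / evidence \<pi>\<^sub>0 g y) \<partial>N \<partial>\<pi>\<^sub>0)"
    by (rule Fubini') measurable
  also have "\<dots> \<le> (\<integral>\<^sup>+x. ennreal (surface_const R) *
      (\<integral>\<^sup>+r\<in>{0..}. K r * ennreal (r ^ (CARD('dy) - 1)) \<partial>lborel) \<partial>\<pi>\<^sub>0)"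
  proof (rule nn_integral_mono)
    \<comment> \<open>\<open>h\<close> need not be measurable, so the likelihood may be replaced by its radial bound only
      once \<open>x\<close> is fixed.\<close>
    fix x assume "x \<in> space \<pi>\<^sub>0"
    then have x: "x \<in> X"
      by (simp add: space_prior)
    have "(\<integral>\<^sup>+y. ennreal ((g y x)\<^sup>2 / evidence \<pi>\<^sub>0 g y) \<partial>N) \<le>
        (\<integral>\<^sup>+y. K (mahalanobis_norm R (y - h x)) \<partial>N)"
    proof (rule nn_integral_mono)
      fix y assume "y \<in> space N"
      then have y: "y \<in> Y"
        by (simp add: space_N)
      show "ennreal ((g y x)\<^sup>2 / evidence \<pi>\<^sub>0 g y) \<le> K (mahalanobis_norm R (y - h x))"
        unfolding K_def g_q[OF x y]
        by (intro ennreal_leI divide_left_mono evidence_lower x y mult_pos_pos evidence_pos q_pos) simp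
    qed
    \<comment> \<open>Passing from \<open>Y\<close> to the whole space can only enlarge the integral
      of a nonnegative function, and makes the radial formula applicable.\<close>
    also have "\<dots> \<le> (\<integral>\<^sup>+y. K (mahalanobis_norm R (y - h x)) \<partial>lborel)"
      unfolding N_def using Y_borel
      by (subst nn_integral_restrict_space) (auto intro!: nn_integral_mono split: split_indicator)
    also have "\<dots> = ennreal (surface_const R) *
        (\<integral>\<^sup>+r\<in>{0..}. K r * ennreal (r ^ (CARD('dy) - 1)) \<partial>lborel)"
      by (rule nn_integral_mahalanobis_norm[OF R]) simp
    finally show "(\<integral>\<^sup>+y. ennreal ((g y x)\<^sup>2 / evidence \<pi>\<^sub>0 g y) \<partial>N) \<le> \<dots>" .
  qed
  \<comment> \<open>The bound no longer depends on \<open>x\<close>, and the prior has total mass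
    1.\<close>
  also have "\<dots> = ennreal (surface_const R) *
      (\<integral>\<^sup>+r\<in>{0..}. K r * ennreal (r ^ (CARD('dy) - 1)) \<partial>lborel)"
    by (simp add: \<pi>.emeasure_space_1)
  also have "(\<integral>\<^sup>+r\<in>{0..}. K r * ennreal (r ^ (CARD('dy) - 1)) \<partial>lborel) =
      (\<integral>\<^sup>+r\<in>{0..}. ennreal ((\<phi> (\<psi> r))\<^sup>2 / \<phi> (\<psi> (r + 2 * M\<^sub>R)) * r ^ (CARD('dy) - 1)) \<partial>lborel)"
  proof (rule nn_integral_cong)
    \<comment> \<open>The truncation in \<open>q\<close> must be inactive at both \<open>r\<close>
      and \<open>r + 2 * M\<^sub>R\<close>. The sign of \<open>M\<^sub>R\<close> is read off at any
      state, and one exists because the prior is a probability measure.\<close>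
    obtain x where "x \<in> X"
      using X_nonempty by blast
    then have "0 \<le> M\<^sub>R"
      using norm_h mahalanobis_norm_nonneg[OF R] order_trans by blast
    then have "K r = ennreal ((\<phi> (\<psi> r))\<^sup>2 / \<phi> (\<psi> (r + 2 * M\<^sub>R)))" if "0 \<le> r" for r
      using that by (simp add: K_def q_def max_def)
    then show "K r * ennreal (r ^ (CARD('dy) - 1)) * indicator {0..} r =
        ennreal ((\<phi> (\<psi> r))\<^sup>2 / \<phi> (\<psi> (r + 2 * M\<^sub>R)) * r ^ (CARD('dy) - 1)) * indicator {0..} r" for r
      by (auto simp flip: ennreal_mult'' split: split_indicator)
  qed
  finally show ?thesis .
qed

end
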